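(* Let $\mathbf A \sim \mathcal W_k(n,\mathbf\Sigma)$ with $\operatorname{rank}(\mathbf\Sigma)=r<k$, and let $\mathbf z\sim\mathcal N_k(\boldsymbol\mu,\kappa\mathbf\Sigma)$ with $\kappa>0$, where $\mathbf A$ and $\mathbf z$ are independent. Let $\mathbf M$ be a $p\times k$ matrix of constants with $\operatorname{rank}(\mathbf M)=p<r\le n$ and $\operatorname{rank}(\mathbf M\mathbf\Sigma)=p$. Put $\mathbf P=(\mathbf M\mathbf\Sigma\mathbf M^T)^{-1/2}\mathbf M\mathbf\Sigma^{1/2}$ and $\mathbf Q=\mathbf P^T\mathbf P$. Then $$\mathbf M\mathbf A\mathbf z \stackrel{d}{=} \zeta\,\mathbf M\mathbf\Sigma^{1/2}\mathbf t+\sqrt{\zeta}\,(\mathbf M\mathbf\Sigma\mathbf M^T)^{1/2}\left[\sqrt{\mathbf t^T\mathbf t}\,\mathbf I_p-\frac{\sqrt{\mathbf t^T\mathbf t}-\sqrt{\mathbf t^T(\mathbf I_k-\mathbf Q)\mathbf t}}{\mathbf t^T\mathbf Q\mathbf t}\,\mathbf P\mathbf t\mathbf t^T\mathbf P^T\right]\mathbf z_0,$$ where $\zeta\sim\chi^2_n$, $\mathbf t\sim\mathcal N_k(\mathbf\Sigma^{1/2}\boldsymbol\mu,\kappa\mathbf\Sigma^2)$ and $\mathbf z_0\sim\mathcal N_p(\mathbf 0,\mathbf I_p)$ are mutually independent.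
   Context: For a $k\times k$ positive semi-definite matrix $\mathbf\Sigma$ (possibly singular) and a positive integer $n$, $\mathbf A\sim\mathcal W_k(n,\mathbf\Sigma)$ means that $\mathbf A \stackrel{d}{=} \mathbf X\mathbf X^T$, where $\mathbf X$ is a $k\times n$ random matrix whose $n$ columns are i.i.d. $\mathcal N_k(\mathbf 0,\mathbf\Sigma)$. $\mathcal N_k(\boldsymbol\mu,\mathbf C)$, for positive semi-definite (possibly singular) $\mathbf C$, is the law of $\boldsymbol\mu+\mathbf C^{1/2}\mathbf g$ with $\mathbf g\sim\mathcal N_k(\mathbf 0,\mathbf I_k)$. For a positive semi-definite matrix $\mathbf B$, $\mathbf B^{1/2}$ is its symmetric positive semi-definite square root, and $\mathbf B^{-1/2}$ its inverse when $\mathbf B$ is positive definite. $\chi^2_n$ is the chi-squared distribution with $n$ degrees of freedom; $\stackrel{d}{=}$ denotes equality in distribution. *)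

theory Defs
  imports "HOL-Analysis.Analysis" "HOL-Probability.Probability"
begin

definition std_normal :: "real measure" where
  "std_normal = density lborel std_normal_density"

definition std_mvnormal :: "(real^'k) measure" where
  "std_mvnormal = distr (PiM UNIV (\<lambda>_::'k. std_normal)) borel (\<lambda>g. vec_lambda g)"

definition psd :: "real^'k^'k \<Rightarrow> bool" where
  "psd C \<longleftrightarrow> transpose C = C \<and> (\<forall>x. 0 \<le> x \<bullet> (C *v x))"

definition msqrt :: "real^'k^'k \<Rightarrow> real^'k^'k" where
  "msqrt C = (THE B. psd B \<and> B ** B = C)"

definition minvsqrt :: "real^'k^'k \<Rightarrow> real^'k^'k" where
  "minvsqrt C = matrix_inv (msqrt C)"

definition mvnormal :: "real^'k \<Rightarrow> real^'k^'k \<Rightarrow> (real^'k) measure" where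
  "mvnormal mu C = distr std_mvnormal borel (\<lambda>g. mu + msqrt C *v g)"

definition vouter :: "real^'m \<Rightarrow> real^'n \<Rightarrow> real^'n^'m" where
  "vouter u v = (\<chi> i j. u $ i * v $ j)"

text \<open>W_k(n, Sigma): law of X X^T = sum of x_i x_i^T, the n columns x_i of X i.i.d. N_k(0,Sigma).\<close>
definition wishart :: "nat \<Rightarrow> real^'k^'k \<Rightarrow> (real^'k^'k) measure" where
  "wishart n S = distr (PiM {..<n} (\<lambda>_. mvnormal 0 S)) borel
      (\<lambda>X. \<Sum>i<n. vouter (X i) (X i))"

definition chi2 :: "nat \<Rightarrow> real measure" where
  "chi2 n = distr (PiM {..<n} (\<lambda>_. std_normal)) borel (\<lambda>g. \<Sum>i<n. (g i)\<^sup>2)"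

end

theory Submission
  imports Defs
begin

text \<open>Both laws are compared through their characteristic functions. Writing
  \<open>A = \<Sigma>\<^sup>1\<^sup>/\<^sup>2 G G\<^sup>T \<Sigma>\<^sup>1\<^sup>/\<^sup>2\<close>, \<open>t = \<Sigma>\<^sup>1\<^sup>/\<^sup>2 z\<close> and \<open>v = \<Sigma>\<^sup>1\<^sup>/\<^sup>2 M\<^sup>T s\<close>, the left-hand side is, conditionally on
  \<open>t\<close>, a sum of \<open>n\<close> independent copies of \<open>(t \<bullet> g) (v \<bullet> g)\<close> in direction \<open>s\<close>. Projecting \<open>g\<close> on \<open>t\<close>
  and on the residual of \<open>v\<close> gives the characteristic function of this product as
  \<open>E exp (h\<^sup>2 (i (t \<bullet> v) - (|t|\<^sup>2 |v|\<^sup>2 - (t \<bullet> v)\<^sup>2) / 2))\<close> with \<open>h\<close> standard normal. On the right-hand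
  side, integrating out \<open>z\<^sub>0\<close> and writing \<open>\<zeta>\<close> as a sum of \<open>n\<close> squares gives the \<open>n\<close>-th power of the
  same expression, because the bracket is the square root of \<open>|t|\<^sup>2 I - P t t\<^sup>T P\<^sup>T\<close>. The law of \<open>t\<close>
  is the same on both sides.\<close>

section \<open>Uniqueness of characteristic functions on Euclidean spaces\<close>

text \<open>Normalising by the common mass \<open>m\<close> turns both weighted laws of
  \<open>Y\<close> into probability measures with equal characteristic functions, so
  \<open>Levy_uniqueness\<close> applies. If \<open>m = 0\<close>, the weight vanishes almost
  everywhere under both measures.\<close>

lemma weighted_Levy_uniqueness:
  fixes w Y :: "'a \<Rightarrow> real"
  assumes M: "prob_space M" and N: "prob_space N"
    and mM [measurable]: "w \<in> borel_measurable M" "Y \<in> borel_measurable M"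
    and mN [measurable]: "w \<in> borel_measurable N" "Y \<in> borel_measurable N"
    and w: "\<And>x. 0 \<le> w x" "\<And>x. w x \<le> C"
    and eq: "\<And>u. (CLINT x|M. w x *\<^sub>R iexp (u * Y x)) = (CLINT x|N. w x *\<^sub>R iexp (u * Y x))"
    and B: "B \<in> sets borel"
  shows "(LINT x|M. w x * indicator B (Y x)) = (LINT x|N. w x * indicator B (Y x))"
proof -
  interpret M: prob_space M by fact
  interpret N: prob_space N by fact
  have iM: "integrable M w"
    by (rule M.integrable_const_bound[of _ C]) (use w in \<open>auto simp: abs_le_iff intro: order_trans\<close>)
  have iN: "integrable N w"
    by (rule N.integrable_const_bound[of _ C]) (use w in \<open>auto simp: abs_le_iff intro: order_trans\<close>)
  define m where "m = (LINT x|M. w x)"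
  \<comment> \<open>At \<open>u = 0\<close> the hypothesis compares the total masses.\<close>
  have mN_eq: "(LINT x|N. w x) = m"
    using eq[of 0] iM iN by (simp add: scaleR_conv_of_real m_def)
  have m0: "m \<ge> 0" unfolding m_def using w by simp
  show ?thesis
  proof (cases "m = 0")
    case True
    have "AE x in M. w x = 0" "AE x in N. w x = 0"
      using integral_nonneg_eq_0_iff_AE[OF iM] integral_nonneg_eq_0_iff_AE[OF iN] w mN_eq True
      by (auto simp: m_def)
    then have "(LINT x|M. w x * indicator B (Y x)) = 0" "(LINT x|N. w x * indicator B (Y x)) = 0"
      by (auto intro!: integral_eq_zero_AE elim!: eventually_mono)
    then show ?thesis by simp
  next
    case False
    define D where "D K = distr (density K (\<lambda>x. ennreal (w x / m))) borel Y" for K :: "'a measure"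
    have wm: "w x / m \<ge> 0" for x using w m0 by simp
    have *: "real_distribution (D K)"
      "char (D K) u = (CLINT x|K. (w x / m) *\<^sub>R iexp (u * Y x))"
      "(LINT x|D K. indicator B x) = (LINT x|K. (w x / m) * indicator B (Y x))"
      if [measurable]: "w \<in> borel_measurable K" "Y \<in> borel_measurable K" and i: "integrable K w"
        and one: "(LINT x|K. w x) = m" for K u
    proof -
      have "prob_space (density K (\<lambda>x. ennreal (w x / m)))"
        using nn_integral_eq_integral[of K "\<lambda>x. w x / m"] i wm one False
        by (intro prob_spaceI) (simp add: emeasure_density cong: nn_integral_cong)
      then show "real_distribution (D K)"
        unfolding D_def by (intro prob_space.real_distribution_distr) auto
      show "char (D K) u = (CLINT x|K. (w x / m) *\<^sub>R iexp (u * Y x))"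
        unfolding char_def D_def using wm by (subst integral_distr) (auto simp: integral_density)
      show "(LINT x|D K. indicator B x) = (LINT x|K. (w x / m) * indicator B (Y x))"
        unfolding D_def using wm B
        by (subst integral_distr) (auto simp: integral_density)
    qed
    have sc: "(CLINT x|K. (w x / m) *\<^sub>R iexp (u * Y x)) = (1 / m) *\<^sub>R (CLINT x|K. w x *\<^sub>R iexp (u * Y x))" for K u
      by (subst integral_scaleR_right[symmetric]) simp
    have "char (D M) u = char (D N) u" for u
      using *(2)[OF mM iM m_def[symmetric]] *(2)[OF mN iN mN_eq] eq by (simp only: sc)
    then have "D M = D N"
      using *(1)[OF mM iM m_def[symmetric]] *(1)[OF mN iN mN_eq] by (intro Levy_uniqueness ext)
    then have "(LINT x|M. (w x / m) * indicator B (Y x)) = (LINT x|N. (w x / m) * indicator B (Y x))"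
      using *(3)[OF mM iM m_def[symmetric]] *(3)[OF mN iN mN_eq] by simp
    then show ?thesis using False by simp
  qed
qed

text \<open>Induction over the coordinates: the positive weights \<open>1 + cos (s \<bullet> x + \<theta>)\<close> reduce the complex
  weight \<open>iexp (s \<bullet> x)\<close> to finite positive measures, to which one-dimensional uniqueness applies.\<close>
lemma char_determines_box_integrals:
  fixes M N :: "'a::euclidean_space measure"
  assumes M: "prob_space M" "sets M = sets borel" and N: "prob_space N" "sets N = sets borel"
    and eq: "\<And>s. (CLINT x|M. iexp (s \<bullet> x)) = (CLINT x|N. iexp (s \<bullet> x))"
    and A: "\<And>b. A b \<in> sets borel"
    and J: "J \<subseteq> Basis"
  shows "(CLINT x|M. (\<Prod>b\<in>J. indicator (A b) (x \<bullet> b)) *\<^sub>R iexp (s \<bullet> x))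
       = (CLINT x|N. (\<Prod>b\<in>J. indicator (A b) (x \<bullet> b)) *\<^sub>R iexp (s \<bullet> x))"
proof -
  have "finite J" using J finite_subset[OF _ finite_Basis] by blast
  then show ?thesis using J
  proof (induct J arbitrary: s rule: finite_induct)
    case empty
    then show ?case using eq by simp
  next
    case (insert b J)
    interpret M: prob_space M by fact
    interpret N: prob_space N by fact
    note A [measurable] M(2) [measurable_cong] N(2) [measurable_cong]
    define p where "p x = (\<Prod>b\<in>J. indicator (A b) (x \<bullet> b) :: real)" for x
    have IH: "(CLINT x|M. p x *\<^sub>R iexp (s \<bullet> x)) = (CLINT x|N. p x *\<^sub>R iexp (s \<bullet> x))" for s
      using insert by (simp add: p_def)
    have [measurable]: "p \<in> borel_measurable borel" unfolding p_def by measurable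
    have p: "0 \<le> p x" "p x \<le> 1" for x
      unfolding p_def by (auto intro!: prod_nonneg prod_le_1 simp: indicator_def)
    define c where "c s \<theta> x = p x * (1 + cos (s \<bullet> x + \<theta>))" for s \<theta> x
    have [measurable]: "c s \<theta> \<in> borel_measurable borel" for s \<theta>
      unfolding c_def by measurable
    have c0: "0 \<le> c s \<theta> x" for s \<theta> x
      unfolding c_def using p cos_ge_minus_one[of "s \<bullet> x + \<theta>"]
      by (intro mult_nonneg_nonneg) (auto simp del: cos_ge_minus_one)
    have c2: "c s \<theta> x \<le> 2" for s \<theta> x
    proof -
      have "1 + cos (s \<bullet> x + \<theta>) \<ge> 0" using cos_ge_minus_one[of "s \<bullet> x + \<theta>"] by linarith
      then show ?thesis
        unfolding c_def using p[of x] cos_le_one[of "s \<bullet> x + \<theta>"]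
          mult_mono[of "p x" 1 "1 + cos (s \<bullet> x + \<theta>)" 2] by simp
    qed
    have int: "integrable K (\<lambda>x. p x *\<^sub>R iexp (s \<bullet> x))"
      if "prob_space K" "sets K = sets borel" for K s
    proof -
      interpret prob_space K by fact
      note that(2) [measurable_cong]
      show ?thesis by (rule integrable_const_bound[of _ 1]) (use p in auto)
    qed
    have lin: "(CLINT x|K. f x + a * g x + b * h x) = (CLINT x|K. f x) + a * (CLINT x|K. g x) + b * (CLINT x|K. h x)"
      and lin2: "(CLINT x|K. f x + a * g x - b * h x) = (CLINT x|K. f x) + a * (CLINT x|K. g x) - b * (CLINT x|K. h x)"
      if "integrable K f" "integrable K g" "integrable K h" for K :: "'a measure" and f g h :: "'a \<Rightarrow> complex" and a b
      using that by simp_all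
    \<comment> \<open>Euler's formula splits the cosine weight into three exponentials weighted by
      \<open>p\<close> alone, each covered by the induction hypothesis at its own argument.\<close>
    have expand: "c s \<theta> x *\<^sub>R iexp (u * (x \<bullet> b)) = p x *\<^sub>R iexp ((u *\<^sub>R b) \<bullet> x)
        + (iexp \<theta> / 2) * (p x *\<^sub>R iexp ((s + u *\<^sub>R b) \<bullet> x))
        + (iexp (-\<theta>) / 2) * (p x *\<^sub>R iexp ((u *\<^sub>R b - s) \<bullet> x))" for s \<theta> u x
    proof -
      have "complex_of_real (cos y) = (iexp y + iexp (- y)) / 2" for y
        unfolding cis_conv_exp[symmetric] by (simp add: complex_eq_iff)
      from this[of "s \<bullet> x + \<theta>"]
      show ?thesis
        unfolding c_def
        by (simp add: scaleR_conv_of_real inner_add_left inner_diff_left inner_commute[of b]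
            exp_add[symmetric] exp_diff algebra_simps add_divide_distrib exp_minus)
    qed
    have key: "(LINT x|M. c s \<theta> x * indicator (A b) (x \<bullet> b)) = (LINT x|N. c s \<theta> x * indicator (A b) (x \<bullet> b))"
      for s \<theta>
    proof (rule weighted_Levy_uniqueness[OF M(1) N(1) _ _ _ _ c0 c2])
      show "(CLINT x|M. c s \<theta> x *\<^sub>R iexp (u * (x \<bullet> b))) = (CLINT x|N. c s \<theta> x *\<^sub>R iexp (u * (x \<bullet> b)))" for u
        unfolding expand lin[OF int[OF M] int[OF M] int[OF M]] lin[OF int[OF N] int[OF N] int[OF N]] IH ..
    qed (use A in measurable)
    have sin: "cos (s \<bullet> x + (- (pi / 2))) = sin (s \<bullet> x)" for s x :: 'a
      by (simp add: cos_diff)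
    \<comment> \<open>The angle 0 yields the real part and \<open>- (pi / 2)\<close> the imaginary
      part. As \<open>cos (pi / 2) = 0\<close>, the third weight is \<open>p\<close> itself;
      subtracting it \<open>1 + \<i>\<close> times removes the constants that made the first two
      weights nonnegative.\<close>
    have expand2: "(\<Prod>b\<in>insert b J. indicator (A b) (x \<bullet> b)) *\<^sub>R iexp (s \<bullet> x)
      = complex_of_real (c s 0 x * indicator (A b) (x \<bullet> b))
        + \<i> * complex_of_real (c s (- (pi / 2)) x * indicator (A b) (x \<bullet> b))
        - (1 + \<i>) * complex_of_real (c 0 (pi / 2) x * indicator (A b) (x \<bullet> b))" for s x
      unfolding cis_conv_exp[symmetric] c_def sin using insert
      by (simp add: p_def[symmetric] complex_eq_iff algebra_simps)
    have int2: "integrable K (\<lambda>x. complex_of_real (c s \<theta> x * indicator (A b) (x \<bullet> b)))"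
      if "prob_space K" "sets K = sets borel" for K s \<theta>
    proof -
      interpret prob_space K by fact
      note that(2) [measurable_cong]
      show ?thesis
        by (rule integrable_const_bound[of _ 2])
          (use c0 c2 in \<open>auto simp: abs_mult abs_le_iff indicator_def norm_mult intro: order_trans[of _ 0]\<close>)
    qed
    show ?case
      unfolding expand2 lin2[OF int2[OF M] int2[OF M] int2[OF M]] lin2[OF int2[OF N] int2[OF N] int2[OF N]]
        integral_complex_of_real key ..
  qed
qed

text \<open>Open boxes form an intersection-stable generator of the Borel sets that exhausts the
  space, and the preceding lemma with \<open>J = Basis\<close> and \<open>s = 0\<close> gives every
  box the same measure.\<close>

theorem char_uniqueness:
  fixes M N :: "'a::euclidean_space measure"
  assumes M: "prob_space M" "sets M = sets borel" and N: "prob_space N" "sets N = sets borel"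
    and eq: "\<And>s. (CLINT x|M. iexp (s \<bullet> x)) = (CLINT x|N. iexp (s \<bullet> x))"
  shows "M = N"
proof (rule measure_eqI_generator_eq)
  interpret M: prob_space M by fact
  interpret N: prob_space N by fact
  let ?E = "range (\<lambda>(a, b). box a b::'a set)"
  show "Int_stable ?E"
    by (auto simp: Int_stable_def box_Int_box)
  show "?E \<subseteq> Pow UNIV" "sets M = sigma_sets UNIV ?E" "sets N = sigma_sets UNIV ?E"
    by (simp_all add: borel_eq_box M N)
  let ?A = "\<lambda>n::nat. box (- (real n *\<^sub>R One)) (real n *\<^sub>R One) :: 'a set"
  show "range ?A \<subseteq> ?E" "(\<Union>i. ?A i) = UNIV"
    unfolding UN_box_eq_UNIV by auto
  show "emeasure M (?A i) \<noteq> \<infinity>" for i by auto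
  show "emeasure M X = emeasure N X" if XE: "X \<in> ?E" for X
  proof -
    obtain l u where X: "X = box l u" using XE by auto
    have ind: "(\<Prod>b\<in>Basis. indicator {l \<bullet> b<..<u \<bullet> b} (x \<bullet> b) :: real) = indicator X x" for x
      unfolding X by (auto simp: indicator_def mem_box)
    have "(CLINT x|M. (\<Prod>b\<in>Basis. indicator {l \<bullet> b<..<u \<bullet> b} (x \<bullet> b)) *\<^sub>R iexp (0 \<bullet> x))
       = (CLINT x|N. (\<Prod>b\<in>Basis. indicator {l \<bullet> b<..<u \<bullet> b} (x \<bullet> b)) *\<^sub>R iexp (0 \<bullet> x))"
      by (rule char_determines_box_integrals[OF M N eq]) auto
    moreover have "X \<in> sets borel" by (simp add: X)
    ultimately have "measure M X = measure N X"
      by (simp add: ind scaleR_conv_of_real M N)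
    then show ?thesis by (simp add: M.emeasure_eq_measure N.emeasure_eq_measure)
  qed
qed

section \<open>Square roots of positive semi-definite matrices\<close>

text \<open>Induction on \<open>dim V\<close>: a maximiser of the quadratic form on the unit sphere
  of \<open>V\<close> is an eigenvector, and its orthogonal complement within \<open>V\<close> is
  invariant again.\<close>

lemma symmetric_eigenbasis:
  fixes A :: "real^'n^'n"
  assumes A: "transpose A = A" and V: "subspace V" "\<And>x. x \<in> V \<Longrightarrow> A *v x \<in> V"
  shows "\<exists>E. E \<subseteq> V \<and> span E = V \<and> (\<forall>x\<in>E. \<exists>l. A *v x = l *\<^sub>R x) \<and> pairwise orthogonal E \<and> (\<forall>x\<in>E. norm x = 1)"
  using V
proof (induction "dim V" arbitrary: V)
  case 0
  then have "V = {0}" using dim_eq_0[of V] subspace_0[of V] by auto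
  then show ?case by (intro exI[of _ "{}"]) auto
next
  case (Suc d)
  have sym: "x \<bullet> (A *v y) = (A *v x) \<bullet> y" for x y
    using A by (metis dot_lmul_matrix vector_transpose_matrix)
  have "\<exists>v\<in>V. v \<noteq> 0" using Suc(2) dim_eq_0[of V] by (metis insertI1 nat.distinct(1) subsetI singletonD)
  then obtain v0 where v0: "v0 \<in> V" "v0 \<noteq> 0" by blast
  let ?S = "sphere 0 1 \<inter> V"
  have "compact ?S" using Suc(3) by (intro compact_Int_closed closed_subspace) auto
  moreover have "v0 /\<^sub>R norm v0 \<in> ?S" using v0 Suc(3) by (auto simp: subspace_scale)
  then have "?S \<noteq> {}" by blast
  moreover have "continuous_on ?S (\<lambda>x. x \<bullet> (A *v x))"
    by (intro continuous_intros linear_continuous_on) auto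
  ultimately obtain v where v: "v \<in> ?S" and max: "\<And>x. x \<in> ?S \<Longrightarrow> x \<bullet> (A *v x) \<le> v \<bullet> (A *v v)"
    using continuous_attains_sup[of ?S "\<lambda>x. x \<bullet> (A *v x)"] by blast
  define l where "l = v \<bullet> (A *v v)"
  have vV: "v \<in> V" and nv: "v \<bullet> v = 1" using v by (auto simp: norm_eq_1)
  have q: "x \<bullet> (A *v x) \<le> l * (x \<bullet> x)" if "x \<in> V" for x
  proof (cases "x = 0")
    case False
    have "x /\<^sub>R norm x \<in> ?S" using that False Suc(3) by (auto simp: subspace_scale)
    from max[OF this] have "(x \<bullet> (A *v x)) / (norm x)\<^sup>2 \<le> l"
      by (simp add: l_def matrix_vector_mult_scaleR power2_eq_square divide_inverse ac_simps)
    then show ?thesis using False by (simp add: pos_divide_le_eq power2_norm_eq_inner)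
  qed simp
  \<comment> \<open>The eigenvector equation is first-order optimality of \<open>v\<close>:
    perturbing \<open>v\<close> along the residual \<open>?d\<close> shows that the residual is
    zero.\<close>
  let ?d = "l *\<^sub>R v - A *v v"
  have dV: "?d \<in> V" using Suc(3,4) vV by (intro subspace_diff subspace_scale) auto
  have "?d \<bullet> ?d = 0"
  proof -
    define c where "c = ?d \<bullet> ?d"
    define K where "K = l * (?d \<bullet> ?d) - ?d \<bullet> (A *v ?d)"
    \<comment> \<open>The gap in the inequality \<open>q\<close> at
      \<open>v + e *\<^sub>R ?d\<close> vanishes for \<open>e = 0\<close>, because \<open>l\<close>
      is the value attained at \<open>v\<close>; it has linear coefficient \<open>2 * c\<close> and
      quadratic coefficient \<open>K\<close>.\<close>
    have e: "0 \<le> 2 * e * c + e\<^sup>2 * K" for e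
    proof -
      have "v + e *\<^sub>R ?d \<in> V" using Suc(3) vV dV by (intro subspace_add subspace_scale)
      from q[OF this] have "0 \<le> l * ((v + e *\<^sub>R ?d) \<bullet> (v + e *\<^sub>R ?d)) - (v + e *\<^sub>R ?d) \<bullet> (A *v (v + e *\<^sub>R ?d))"
        by simp
      also have "\<dots> = 2 * e * (l * (v \<bullet> ?d) - v \<bullet> (A *v ?d)) + e\<^sup>2 * K"
      proof -
        define D where "D = ?d"
        have K: "K = l * (D \<bullet> D) - D \<bullet> (A *v D)" unfolding K_def D_def ..
        show ?thesis unfolding K D_def[symmetric]
          by (simp add: inner_add_left inner_add_right matrix_vector_right_distrib
            matrix_vector_mult_scaleR sym[of D v] inner_commute[of D v] inner_commute[of "A *v D" v] inner_commute[of "A *v D" D]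
            nv l_def[symmetric] power2_eq_square algebra_simps)
      qed
      also have "l * (v \<bullet> ?d) - v \<bullet> (A *v ?d) = c"
        unfolding c_def sym by (simp add: inner_diff_left)
      finally show ?thesis by simp
    qed
    have c0: "c \<ge> 0" by (simp add: c_def)
    show ?thesis
    proof (rule ccontr)
      assume "?d \<bullet> ?d \<noteq> 0"
      then have c: "c > 0" using c0 by (simp add: c_def)
      \<comment> \<open>With \<open>k\<close> positive and at least \<open>K\<close>, the choice
        \<open>e = - c / k\<close> gives \<open>e\<^sup>2 * k = - e * c\<close>, so the gap is at
        most \<open>e * c\<close>, which is negative.\<close>
      define k where "k = \<bar>K\<bar> + 1"
      have k: "k > 0" "K \<le> k" by (auto simp: k_def)
      define e where "e = - c / k"
      have "e < 0" using c k by (simp add: e_def field_simps)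
      have "e\<^sup>2 * K \<le> e\<^sup>2 * k" using k by (intro mult_left_mono) auto
      also have "\<dots> = - e * c" using k by (simp add: e_def power2_eq_square field_simps)
      finally have "0 \<le> e * c" using e[of e] by (simp add: algebra_simps)
      then show False using c \<open>e < 0\<close> by (simp add: zero_le_mult_iff)
    qed
  qed
  then have Av: "A *v v = l *\<^sub>R v" by simp
  \<comment> \<open>Symmetry of \<open>A\<close> keeps the complement of the eigenvector invariant;
    its dimension is one less, so the induction hypothesis supplies the remaining basis
    vectors.\<close>
  define W where "W = {x \<in> V. orthogonal v x}"
  have W: "subspace W"
    unfolding W_def using Suc(3) by (auto simp: subspace_def orthogonal_clauses)
  have AW: "A *v x \<in> W" if "x \<in> W" for x
    using that Suc(4) by (auto simp: W_def orthogonal_def sym Av)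
  have spanW: "span (insert v W) = V"
  proof
    show "span (insert v W) \<subseteq> V" using vV Suc(3) by (intro span_minimal) (auto simp: W_def)
    show "V \<subseteq> span (insert v W)"
    proof
      fix x assume x: "x \<in> V"
      have "x - (v \<bullet> x) *\<^sub>R v \<in> W"
        using x vV Suc(3) nv by (auto simp: W_def orthogonal_def inner_diff_right intro!: subspace_diff subspace_scale)
      then show "x \<in> span (insert v W)"
        unfolding span_insert using span_base by blast
    qed
  qed
  have "v \<notin> span W" using W nv by (auto simp: W_def orthogonal_def span_eq_iff[THEN iffD2])
  then have "dim V = Suc (dim W)"
    using dim_insert[of v W] spanW by (metis dim_span Suc_eq_plus1)
  then obtain E where E: "E \<subseteq> W" "span E = W" "\<forall>x\<in>E. \<exists>l. A *v x = l *\<^sub>R x" "pairwise orthogonal E" "\<forall>x\<in>E. norm x = 1"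
    using Suc(1)[of W] Suc(2) W AW by auto
  show ?case
  proof (intro exI[of _ "insert v E"] conjI)
    show "insert v E \<subseteq> V" using E vV by (auto simp: W_def)
    show "span (insert v E) = V" using spanW E(2) W by (auto simp: span_insert span_eq_iff[THEN iffD2])
    show "\<forall>x\<in>insert v E. \<exists>l. A *v x = l *\<^sub>R x" using Av E by blast
    show "pairwise orthogonal (insert v E)"
      using E by (auto simp: pairwise_insert W_def orthogonal_commute)
    show "\<forall>x\<in>insert v E. norm x = 1" using E v by auto
  qed
qed

section \<open>Existence and uniqueness of the positive semi-definite square root\<close>

lemma psd_symD: "psd C \<Longrightarrow> x \<bullet> (C *v y) = (C *v x) \<bullet> y"
  by (metis dot_lmul_matrix psd_def vector_transpose_matrix)

lemma matrix_eq_on_span: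
  fixes A B :: "real^'n^'n"
  assumes "span E = UNIV" "\<And>x. x \<in> E \<Longrightarrow> A *v x = B *v x"
  shows "A = B"
proof -
  have "A *v x = B *v x" for x
    using linear_eq_on[of "(*v) A" "(*v) B" x E] assms by auto
  then show ?thesis by (simp add: matrix_eq)
qed

text \<open>In an orthonormal eigenbasis each eigenvalue, nonnegative by semi-definiteness, is
  replaced by its square root.\<close>

lemma psd_sqrt_exists:
  assumes "psd C"
  shows "\<exists>B. psd B \<and> B ** B = C"
proof -
  obtain E where E: "span E = UNIV" "\<And>x. x \<in> E \<Longrightarrow> \<exists>l. C *v x = l *\<^sub>R x"
    "pairwise orthogonal E" "\<And>x. x \<in> E \<Longrightarrow> norm x = 1"
    using symmetric_eigenbasis[of C UNIV] assms by (auto simp: psd_def)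
  obtain l where l: "\<And>x. x \<in> E \<Longrightarrow> C *v x = l x *\<^sub>R x" using E(2) by metis
  have nE: "x \<bullet> x = 1" if "x \<in> E" for x using E(4)[OF that] by (simp add: norm_eq_1)
  have l0: "l x \<ge> 0" if "x \<in> E" for x
    using assms l[OF that] nE[OF that] unfolding psd_def by (metis inner_scaleR_right mult.right_neutral)
  have "finite E"
    using E(3,4) by (intro independent_imp_finite pairwise_orthogonal_independent) force+
  define f where "f x = (\<Sum>e\<in>E. (sqrt (l e) * (e \<bullet> x)) *\<^sub>R e)" for x
  have "linear f"
    by (intro linearI)
      (simp_all add: f_def inner_add_right distrib_left scaleR_add_left sum.distrib scaleR_sum_right mult_ac)
  then have f: "matrix f *v x = f x" for x by (simp add: matrix_works)
  have fE: "f x = sqrt (l x) *\<^sub>R x" if "x \<in> E" for x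
  proof -
    have "f x = (\<Sum>e\<in>E. if e = x then sqrt (l x) *\<^sub>R x else 0)"
      unfolding f_def using E(3) that nE
      by (intro sum.cong) (auto simp: pairwise_def orthogonal_def)
    then show ?thesis using \<open>finite E\<close> that by simp
  qed
  have fsym: "f x \<bullet> y = x \<bullet> f y" for x y
    by (simp add: f_def inner_sum_left inner_sum_right inner_commute mult_ac)
  have "transpose (matrix f) = matrix f"
  proof -
    have "x \<bullet> (transpose (matrix f) *v y) = x \<bullet> (matrix f *v y)" for x y
      using fsym[of x y]
      by (metis dot_lmul_matrix f transpose_transpose vector_transpose_matrix)
    then show ?thesis
      by (metis matrix_eq vector_eq_ldot)
  qed
  moreover have "0 \<le> x \<bullet> (matrix f *v x)" for x
  proof -
    have "x \<bullet> f x = (\<Sum>e\<in>E. sqrt (l e) * (e \<bullet> x)\<^sup>2)"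
      by (simp add: f_def inner_sum_right inner_commute power2_eq_square mult.assoc)
    then show ?thesis unfolding f using l0 by (auto intro!: sum_nonneg)
  qed
  moreover have "matrix f ** matrix f = C"
    by (rule matrix_eq_on_span[OF E(1)])
      (simp add: matrix_vector_mul_assoc[symmetric] f fE matrix_vector_mult_scaleR l l0 scaleR_scaleR
        linear_scale[OF \<open>linear f\<close>])
  ultimately show ?thesis by (auto simp: psd_def)
qed

text \<open>The vector \<open>y = B *v x - sqrt l *\<^sub>R x\<close> is mapped by \<open>B\<close>
  to \<open>- sqrt l *\<^sub>R y\<close>, which contradicts semi-definiteness unless
  \<open>y = 0\<close> or \<open>l = 0\<close>. For \<open>l = 0\<close> the squared norm of
  \<open>B *v x\<close> is zero.\<close>

lemma psd_sqrt_eigenvector: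
  assumes B: "psd B" and x: "B *v (B *v x) = l *\<^sub>R x" and "x \<noteq> 0"
  shows "B *v x = sqrt l *\<^sub>R x"
proof -
  have "l * (x \<bullet> x) = (B *v x) \<bullet> (B *v x)"
    using psd_symD[OF B, of x "B *v x"] x by simp
  then have l: "l \<ge> 0" using \<open>x \<noteq> 0\<close>
    by (metis inner_ge_zero inner_gt_zero_iff zero_le_mult_iff not_le)
  define y where "y = B *v x - sqrt l *\<^sub>R x"
  have By: "B *v y = - sqrt l *\<^sub>R y"
    using l by (simp add: y_def matrix_vector_mult_diff_distrib matrix_vector_mult_scaleR x scaleR_diff_right)
  have "0 \<le> y \<bullet> (B *v y)" using B by (simp add: psd_def)
  then have *: "sqrt l * (y \<bullet> y) \<le> 0" by (simp add: By)
  show ?thesis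
  proof (cases "l = 0")
    case True
    then show ?thesis using \<open>l * (x \<bullet> x) = (B *v x) \<bullet> (B *v x)\<close> by simp
  next
    case False
    then have "y \<bullet> y \<le> 0" using * l by (simp add: mult_le_0_iff)
    then have "y = 0" by (metis inner_gt_zero_iff not_le)
    then show ?thesis by (simp add: y_def)
  qed
qed

text \<open>The common square has a spanning set of eigenvectors, and on each of them a
  semi-definite root can only act as the root of the eigenvalue.\<close>

lemma psd_sqrt_unique:
  assumes "psd B" "psd B'" "B ** B = B' ** B'"
  shows "B = B'"
proof -
  have "transpose (B ** B) = B ** B" using assms by (simp add: psd_def matrix_transpose_mul)
  then obtain E where E: "span E = UNIV" "\<And>x. x \<in> E \<Longrightarrow> \<exists>l. (B ** B) *v x = l *\<^sub>R x"
    "\<And>x. x \<in> E \<Longrightarrow> norm x = 1"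
    using symmetric_eigenbasis[of "B ** B" UNIV] by auto
  show ?thesis
  proof (rule matrix_eq_on_span[OF E(1)])
    fix x assume x: "x \<in> E"
    then obtain l where l: "(B ** B) *v x = l *\<^sub>R x" using E by blast
    have "x \<noteq> 0" using E(3)[OF x] by auto
    then show "B *v x = B' *v x"
      using psd_sqrt_eigenvector[OF assms(1), of x l] psd_sqrt_eigenvector[OF assms(2), of x l] l assms(3)
      by (simp add: matrix_vector_mul_assoc)
  qed
qed

lemma msqrt_eqI: "psd B \<Longrightarrow> B ** B = C \<Longrightarrow> msqrt C = B"
  unfolding msqrt_def by (rule the_equality) (auto intro: psd_sqrt_unique)

lemma msqrt:
  assumes "psd C"
  shows psd_msqrt: "psd (msqrt C)" and msqrt_mult_self: "msqrt C ** msqrt C = C"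
  using psd_sqrt_exists[OF assms] msqrt_eqI by metis+

lemma psd_scaleR: "psd C \<Longrightarrow> 0 \<le> c \<Longrightarrow> psd (c *\<^sub>R C)"
  by (auto simp: psd_def scaleR_matrix_vector_assoc[symmetric] transpose_scalar)

text \<open>Used with \<open>B\<close> equal to the root of \<Sigma> and to \<Sigma> itself, for the
  covariances of \<open>z\<close> and of \<open>t\<close>.\<close>

lemma msqrt_scaleR_square:
  assumes "psd B" "c \<ge> 0" shows "msqrt (c *\<^sub>R (B ** B)) = sqrt c *\<^sub>R B"
  using assms by (intro msqrt_eqI psd_scaleR) (auto simp: scalar_matrix_assoc matrix_scalar_ac)

lemma msqrt_mat_1: "msqrt (mat 1) = mat 1"
  by (rule msqrt_eqI) (auto simp: psd_def)

lemma psd_congruence: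
  fixes B :: "real^'k^'p"
  shows "psd (B ** transpose B)"
proof -
  have "x \<bullet> ((B ** transpose B) *v x) = (transpose B *v x) \<bullet> (transpose B *v x)" for x
    by (metis dot_lmul_matrix matrix_vector_mul_assoc transpose_matrix_vector)
  then show ?thesis by (simp add: psd_def matrix_transpose_mul)
qed

section \<open>Gaussian characteristic functions\<close>

lemma borel_measurable_vec_lambda [measurable (raw)]:
  fixes f :: "'i::finite \<Rightarrow> 'a \<Rightarrow> real"
  assumes "\<And>i. f i \<in> borel_measurable M"
  shows "(\<lambda>x. \<chi> i. f i x) \<in> borel_measurable M"
  by (subst borel_measurable_euclidean_space) (auto simp: Basis_vec_def inner_axis assms)

lemma borel_measurable_matrix_vector_mult [measurable (raw)]:
  fixes f :: "'a \<Rightarrow> real^'n^'m"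
  assumes [measurable]: "f \<in> borel_measurable M" "g \<in> borel_measurable M"
  shows "(\<lambda>x. f x *v g x) \<in> borel_measurable M"
proof -
  have "continuous_on UNIV (\<lambda>p::(real^'n^'m) \<times> (real^'n). fst p *v snd p)"
    unfolding matrix_vector_mult_def by (intro continuous_intros)
  then have "(\<lambda>p::(real^'n^'m) \<times> (real^'n). fst p *v snd p) \<in> borel_measurable (borel \<Otimes>\<^sub>M borel)"
    unfolding borel_prod by (rule borel_measurable_continuous_onI)
  from measurable_compose[OF _ this, of "\<lambda>x. (f x, g x)" M] show ?thesis by simp
qed

lemma borel_measurable_vouter [measurable (raw)]:
  fixes f :: "'a \<Rightarrow> real^'m" and g :: "'a \<Rightarrow> real^'n"
  assumes [measurable]: "f \<in> borel_measurable M" "g \<in> borel_measurable M"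
  shows "(\<lambda>x. vouter (f x) (g x)) \<in> borel_measurable M"
proof -
  have "continuous_on UNIV (\<lambda>p::(real^'m) \<times> (real^'n). vouter (fst p) (snd p))"
    unfolding vouter_def by (intro continuous_intros)
  then have "(\<lambda>p::(real^'m) \<times> (real^'n). vouter (fst p) (snd p)) \<in> borel_measurable (borel \<Otimes>\<^sub>M borel)"
    unfolding borel_prod by (rule borel_measurable_continuous_onI)
  from measurable_compose[OF _ this, of "\<lambda>x. (f x, g x)" M] show ?thesis by simp
qed

text \<open>Source of the \<open>n\<close>-th powers: it serves both the \<open>n\<close> Wishart
  columns and the \<open>n\<close> squares behind \<open>chi2\<close>.\<close>

lemma integral_PiM_power:
  fixes f :: "'a \<Rightarrow> complex"
  assumes "prob_space M" "integrable M f"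
  shows "(\<integral>X. (\<Prod>i<n. f (X i)) \<partial>PiM {..<n} (\<lambda>_. M)) = (\<integral>x. f x \<partial>M) ^ n"
proof -
  interpret prob_space M by fact
  interpret product_sigma_finite "\<lambda>_::nat. M" ..
  show ?thesis using assms by (subst product_integral_prod) auto
qed

section \<open>Standard normal vectors and their projections\<close>

lemma sets_std_normal [simp, measurable_cong]: "sets std_normal = sets borel"
  by (simp add: std_normal_def)

lemma prob_space_std_normal: "prob_space std_normal"
  using prob_space_normal_density[of 1 0] by (simp add: std_normal_def)

lemma std_normal_char: "(CLINT x|std_normal. iexp (u * x)) = complex_of_real (exp (- u\<^sup>2 / 2))"
  using fun_cong[OF char_std_normal_distribution, of u] by (simp add: char_def std_normal_def)

lemma sets_std_mvnormal [simp, measurable_cong]: "sets std_mvnormal = sets borel"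
  by (simp add: std_mvnormal_def)

lemma prob_space_std_mvnormal: "prob_space std_mvnormal"
  unfolding std_mvnormal_def
  by (intro prob_space.prob_space_distr prob_space_PiM prob_space_std_normal) measurable

lemma std_mvnormal_char:
  fixes v :: "real^'k"
  shows "(CLINT x|std_mvnormal. iexp (v \<bullet> x)) = complex_of_real (exp (- (v \<bullet> v) / 2))"
proof -
  interpret prob_space std_normal by (rule prob_space_std_normal)
  interpret product_sigma_finite "\<lambda>_::'k. std_normal" ..
  have "(CLINT x|std_mvnormal. iexp (v \<bullet> x)) = (CLINT g|PiM UNIV (\<lambda>_::'k. std_normal). iexp (v \<bullet> vec_lambda g))"
    unfolding std_mvnormal_def by (rule integral_distr) measurable
  also have "\<dots> = (CLINT g|PiM UNIV (\<lambda>_::'k. std_normal). (\<Prod>i\<in>UNIV. iexp (v $ i * g i)))"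
    by (simp add: inner_vec_def exp_sum[symmetric] sum_distrib_left)
  also have "\<dots> = (\<Prod>i\<in>UNIV. CLINT x|std_normal. iexp (v $ i * x))"
    by (intro product_integral_prod integrable_const_bound[of _ 1]) auto
  also have "\<dots> = complex_of_real (exp (- (v \<bullet> v) / 2))"
    unfolding std_normal_char of_real_prod[symmetric] exp_sum[OF finite, symmetric]
    by (simp add: inner_vec_def power2_eq_square sum_negf sum_divide_distrib)
  finally show ?thesis .
qed

lemma integral_complex_pair_fst:
  fixes f :: "'a \<Rightarrow> 'b \<Rightarrow> complex"
  assumes "prob_space M" "prob_space N" "(\<lambda>(x, y). f x y) \<in> borel_measurable (M \<Otimes>\<^sub>M N)" "\<And>x y. norm (f x y) \<le> 1"
  shows "(\<integral>p. (case p of (x, y) \<Rightarrow> f x y) \<partial>(M \<Otimes>\<^sub>M N)) = (\<integral>x. \<integral>y. f x y \<partial>N \<partial>M)"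
    and "(\<integral>p. (case p of (x, y) \<Rightarrow> f x y) \<partial>(M \<Otimes>\<^sub>M N)) = (\<integral>y. \<integral>x. f x y \<partial>M \<partial>N)"
proof -
  interpret M: prob_space M by fact
  interpret N: prob_space N by fact
  interpret pair_prob_space M N ..
  have "integrable (M \<Otimes>\<^sub>M N) (\<lambda>(x, y). f x y)"
    by (rule P.integrable_const_bound[of _ 1]) (use assms in auto)
  from integral_fst[OF this] integral_snd[OF this]
  show "(\<integral>p. (case p of (x, y) \<Rightarrow> f x y) \<partial>(M \<Otimes>\<^sub>M N)) = (\<integral>x. \<integral>y. f x y \<partial>N \<partial>M)"
    and "(\<integral>p. (case p of (x, y) \<Rightarrow> f x y) \<partial>(M \<Otimes>\<^sub>M N)) = (\<integral>y. \<integral>x. f x y \<partial>M \<partial>N)"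
    by simp_all
qed

text \<open>Cauchy-Schwarz makes the radicand nonnegative; for \<open>t = 0\<close> the quotient is
  0 by the convention for division by zero.\<close>

lemma projection_residual_square:
  fixes t v :: "'a::real_inner"
  shows "(sqrt ((norm v)\<^sup>2 - ((t \<bullet> v) / norm t)\<^sup>2))\<^sup>2 = (norm v)\<^sup>2 - ((t \<bullet> v) / norm t)\<^sup>2"
proof (cases "t = 0")
  case False
  then have "\<bar>(t \<bullet> v) / norm t\<bar> \<le> norm v"
    using Cauchy_Schwarz_ineq2[of t v] by (simp add: field_simps)
  then show ?thesis
    by (metis abs_norm_cancel abs_le_square_iff diff_ge_0_iff_ge real_sqrt_pow2)
qed simp

text \<open>The pair \<open>(t \<bullet> g, v \<bullet> g)\<close> is realised by two independent standard normals through the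
  Cholesky factor of its covariance matrix.\<close>
lemma std_mvnormal_two_projections:
  fixes t v :: "real^'k"
  assumes "t \<noteq> 0"
  defines "a \<equiv> norm t" and "b \<equiv> (t \<bullet> v) / norm t"
  defines "e \<equiv> sqrt ((norm v)\<^sup>2 - b\<^sup>2)"
  shows "distr std_mvnormal borel (\<lambda>g. (t \<bullet> g, v \<bullet> g))
       = distr (std_normal \<Otimes>\<^sub>M std_normal) borel (\<lambda>(h, h'). (a * h, b * h + e * h'))" (is "?L = ?R")
proof (rule char_uniqueness)
  have m1 [measurable]: "(\<lambda>g. (t \<bullet> g, v \<bullet> g)) \<in> borel_measurable borel"
    unfolding borel_prod[symmetric] by measurable
  have m2 [measurable]: "(\<lambda>(h, h'). (a * h, b * h + e * h')) \<in> borel_measurable (std_normal \<Otimes>\<^sub>M std_normal)"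
    unfolding borel_prod[symmetric] by measurable
  show "prob_space ?L"
    by (intro prob_space.prob_space_distr prob_space_std_mvnormal) measurable
  show "prob_space ?R"
    by (intro prob_space.prob_space_distr prob_space_pair prob_space_std_normal) measurable
  have e: "e\<^sup>2 = (norm v)\<^sup>2 - b\<^sup>2"
    unfolding e_def b_def by (rule projection_residual_square)
  fix s :: "real \<times> real"
  obtain x y where s: "s = (x, y)" by (cases s)
  have "(CLINT p|?L. iexp (s \<bullet> p)) = (CLINT g|std_mvnormal. iexp ((x *\<^sub>R t + y *\<^sub>R v) \<bullet> g))"
    by (subst integral_distr) (auto simp: s inner_add_left)
  also have "\<dots> = complex_of_real (exp (- ((x * a + y * b)\<^sup>2 + (y * e)\<^sup>2) / 2))"
  proof -
    have "a * b = t \<bullet> v" using assms(1) by (simp add: a_def b_def)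
    moreover have "(x *\<^sub>R t + y *\<^sub>R v) \<bullet> (x *\<^sub>R t + y *\<^sub>R v) = x\<^sup>2 * a\<^sup>2 + 2 * x * y * (t \<bullet> v) + y\<^sup>2 * (norm v)\<^sup>2"
      by (simp add: inner_add_left inner_add_right a_def power2_norm_eq_inner inner_commute[of v t]
        power2_eq_square[of x] power2_eq_square[of y] algebra_simps)
    ultimately have "(x *\<^sub>R t + y *\<^sub>R v) \<bullet> (x *\<^sub>R t + y *\<^sub>R v) = (x * a + y * b)\<^sup>2 + (y * e)\<^sup>2"
      by (simp add: power_mult_distrib e power2_sum algebra_simps)
    then show ?thesis unfolding std_mvnormal_char by simp
  qed
  \<comment> \<open>The exponential of the sum of two squares factors into the one-dimensional
    characteristic functions at \<open>x * a + y * b\<close> and \<open>y * e\<close>.\<close>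
  also have "\<dots> = (CLINT h|std_normal. CLINT h'|std_normal. iexp ((x * a + y * b) * h) * iexp (y * e * h'))"
    by (simp only: integral_mult_right_zero integral_mult_left_zero std_normal_char)
      (simp add: add_divide_distrib flip: of_real_mult exp_add)
  also have "\<dots> = (CLINT h|std_normal. CLINT h'|std_normal. iexp (s \<bullet> (a * h, b * h + e * h')))"
    by (simp add: s exp_add[symmetric] algebra_simps)
  also have "\<dots> = (\<integral>p. (case p of (h, h') \<Rightarrow> iexp (s \<bullet> (a * h, b * h + e * h'))) \<partial>(std_normal \<Otimes>\<^sub>M std_normal))"
    by (rule integral_complex_pair_fst(1)[symmetric]) (use prob_space_std_normal in \<open>auto simp: s\<close>)
  also have "\<dots> = (CLINT p|?R. iexp (s \<bullet> p))"
    by (subst integral_distr) (auto simp: case_prod_unfold)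
  finally show "(CLINT p|?L. iexp (s \<bullet> p)) = (CLINT p|?R. iexp (s \<bullet> p))" .
qed auto

text \<open>Contribution of one Wishart column given \<open>t\<close>; both sides of the theorem
  reduce to the mean over \<open>t\<close> of its \<open>n\<close>-th power.\<close>

definition bilinear_char :: "real^'k \<Rightarrow> real^'k \<Rightarrow> complex" where
  "bilinear_char t v = (CLINT g|std_mvnormal. iexp ((t \<bullet> g) * (v \<bullet> g)))"

text \<open>In the Cholesky coordinates the product is \<open>a * h * (b * h + e * h')\<close>.
  Integrating out \<open>h'\<close> leaves a Gaussian factor in \<open>a * e * h\<close>, and
  \<open>a\<^sup>2 * e\<^sup>2\<close> is the Gram determinant of \<open>t\<close> and
  \<open>v\<close>.\<close>

lemma bilinear_char_eq:
  fixes t v :: "real^'k"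
  shows "bilinear_char t v = (CLINT h|std_normal.
    exp (complex_of_real (h\<^sup>2) * (\<i> * (t \<bullet> v) - ((norm t)\<^sup>2 * (norm v)\<^sup>2 - (t \<bullet> v)\<^sup>2) / 2)))"
proof (cases "t = 0")
  \<comment> \<open>Both integrands are constantly 1 here; the projection onto the direction of
    \<open>t\<close> requires \<open>t \<noteq> 0\<close>.\<close>
  case True
  interpret M: prob_space std_normal by (rule prob_space_std_normal)
  interpret N: prob_space "std_mvnormal :: (real^'k) measure" by (rule prob_space_std_mvnormal)
  show ?thesis
    using M.prob_space N.prob_space by (simp add: True bilinear_char_def)
next
  case False
  define a b e where "a = norm t" and "b = (t \<bullet> v) / norm t" and "e = sqrt ((norm v)\<^sup>2 - b\<^sup>2)"
  have e: "e\<^sup>2 = (norm v)\<^sup>2 - b\<^sup>2"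
    unfolding e_def b_def by (rule projection_residual_square)
  have m1 [measurable]: "(\<lambda>g. (t \<bullet> g, v \<bullet> g)) \<in> borel_measurable borel"
    unfolding borel_prod[symmetric] by measurable
  have m2 [measurable]: "(\<lambda>(h, h'). (a * h, b * h + e * h')) \<in> borel_measurable (std_normal \<Otimes>\<^sub>M std_normal)"
    unfolding borel_prod[symmetric] by measurable
  have m3 [measurable]: "(\<lambda>p::real \<times> real. exp (\<i> * (complex_of_real (fst p) * complex_of_real (snd p)))) \<in> borel_measurable borel"
    by (intro borel_measurable_continuous_onI continuous_intros)
  have "bilinear_char t v = (CLINT p|distr std_mvnormal borel (\<lambda>g. (t \<bullet> g, v \<bullet> g)). iexp (fst p * snd p))"
    unfolding bilinear_char_def by (subst integral_distr) auto
  also have "\<dots> = (\<integral>p. (case p of (h, h') \<Rightarrow> iexp (a * h * (b * h + e * h'))) \<partial>(std_normal \<Otimes>\<^sub>M std_normal))"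
    unfolding std_mvnormal_two_projections[OF False]
    unfolding b_def[symmetric] unfolding e_def[symmetric] a_def[symmetric]
    by (subst integral_distr) (auto simp: case_prod_unfold)
  also have "\<dots> = (CLINT h|std_normal. CLINT h'|std_normal. iexp (a * h * (b * h + e * h')))"
    by (rule integral_complex_pair_fst(1)) (use prob_space_std_normal in auto)
  also have "\<dots> = (CLINT h|std_normal. CLINT h'|std_normal. iexp (a * b * h\<^sup>2) * iexp ((a * e * h) * h'))"
    by (simp add: exp_add[symmetric] algebra_simps power2_eq_square)
  also have "\<dots> = (CLINT h|std_normal. iexp (a * b * h\<^sup>2) * complex_of_real (exp (- (a * e * h)\<^sup>2 / 2)))"
    by (simp only: integral_mult_right_zero std_normal_char)
  also have "\<dots> = (CLINT h|std_normal. exp (complex_of_real (h\<^sup>2) * (\<i> * (t \<bullet> v) - ((norm t)\<^sup>2 * (norm v)\<^sup>2 - (t \<bullet> v)\<^sup>2) / 2)))"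
  proof -
    have ab: "a * b = t \<bullet> v" using False by (simp add: a_def b_def)
    have "(a * e * h)\<^sup>2 = h\<^sup>2 * ((norm t)\<^sup>2 * (norm v)\<^sup>2 - (t \<bullet> v)\<^sup>2)" for h
      using ab by (simp add: power_mult_distrib e a_def[symmetric] ab[symmetric] algebra_simps)
    then have "iexp (a * b * h\<^sup>2) * complex_of_real (exp (- (a * e * h)\<^sup>2 / 2))
      = exp (complex_of_real (h\<^sup>2) * (\<i> * (t \<bullet> v) - ((norm t)\<^sup>2 * (norm v)\<^sup>2 - (t \<bullet> v)\<^sup>2) / 2))" for h
      by (simp only: ab exp_of_real[symmetric] exp_add[symmetric]) (simp add: algebra_simps diff_divide_distrib)
    then show ?thesis by (simp only:)
  qed
  finally show ?thesis .
qed

section \<open>Normal, Wishart and chi-squared laws\<close>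

lemma sets_mvnormal [simp, measurable_cong]: "sets (mvnormal mu C) = sets borel"
  by (simp add: mvnormal_def)

lemma prob_space_mvnormal: "prob_space (mvnormal mu C)"
  unfolding mvnormal_def by (intro prob_space.prob_space_distr prob_space_std_mvnormal) measurable

lemma mvnormal_0_mat_1: "mvnormal 0 (mat 1) = std_mvnormal"
  using distr_id2[of borel std_mvnormal] by (simp add: mvnormal_def msqrt_mat_1 id_def)

lemma integral_mvnormal:
  fixes f :: "real^'k \<Rightarrow> complex"
  assumes "f \<in> borel_measurable borel"
  shows "(\<integral>x. f x \<partial>mvnormal mu C) = (\<integral>g. f (mu + msqrt C *v g) \<partial>std_mvnormal)"
  unfolding mvnormal_def using assms by (intro integral_distr) measurable

lemma borel_measurable_wishart_map [measurable]:
  "(\<lambda>X. \<Sum>i<n. vouter (X i) (X i)) \<in> borel_measurable (PiM {..<n} (\<lambda>_. mvnormal 0 (S :: real^'k^'k)))"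
  by (intro borel_measurable_sum borel_measurable_vouter) measurable

lemma sets_wishart [simp, measurable_cong]: "sets (wishart n S) = sets borel"
  by (simp add: wishart_def)

lemma prob_space_wishart: "prob_space (wishart n (S :: real^'k^'k))"
  unfolding wishart_def
  by (intro prob_space.prob_space_distr prob_space_PiM prob_space_mvnormal) measurable

lemma sets_chi2 [simp, measurable_cong]: "sets (chi2 n) = sets borel"
  by (simp add: chi2_def)

lemma prob_space_chi2: "prob_space (chi2 n)"
  unfolding chi2_def
  by (intro prob_space.prob_space_distr prob_space_PiM prob_space_std_normal) measurable

lemma vouter_mult_vector: "vouter x y *v z = (y \<bullet> z) *\<^sub>R x"
  by (simp add: vec_eq_iff vouter_def matrix_vector_mult_def inner_vec_def sum_distrib_left mult_ac)

text \<open>The bilinear form is the sum of \<open>(X i \<bullet> z) * (X i \<bullet> u)\<close>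
  over independent columns. Each column is the root of \<open>S\<close> applied to a standard normal
  vector, and symmetry moves that root onto \<open>z\<close> and \<open>u\<close>.\<close>

lemma wishart_bilinear_char:
  assumes S: "psd S"
  shows "(CLINT A|wishart n S. iexp (u \<bullet> (A *v z))) = bilinear_char (msqrt S *v z) (msqrt S *v u) ^ n"
proof -
  note sym = psd_symD[OF psd_msqrt[OF S]]
  interpret prob_space "mvnormal 0 S" by (rule prob_space_mvnormal)
  have sum: "(\<Sum>i\<in>I. vouter (X i) (X i)) *v z = (\<Sum>i\<in>I. (X i \<bullet> z) *\<^sub>R X i)"
    if "finite I" for I and X :: "nat \<Rightarrow> real^'a"
    using that by induct (simp_all add: matrix_vector_mult_add_rdistrib vouter_mult_vector)
  have "(CLINT A|wishart n S. iexp (u \<bullet> (A *v z)))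
      = (CLINT X|PiM {..<n} (\<lambda>_. mvnormal 0 S). iexp (u \<bullet> ((\<Sum>i<n. vouter (X i) (X i)) *v z)))"
    unfolding wishart_def by (rule integral_distr) measurable
  also have "\<dots> = (CLINT X|PiM {..<n} (\<lambda>_. mvnormal 0 S). (\<Prod>i<n. iexp ((X i \<bullet> z) * (X i \<bullet> u))))"
    by (simp add: sum inner_sum_right exp_sum[symmetric] sum_distrib_left inner_commute[of u])
  also have "\<dots> = (CLINT x|mvnormal 0 S. iexp ((x \<bullet> z) * (x \<bullet> u))) ^ n"
    by (intro integral_PiM_power prob_space_mvnormal integrable_const_bound[of _ 1]) auto
  also have "(CLINT x|mvnormal 0 S. iexp ((x \<bullet> z) * (x \<bullet> u))) = bilinear_char (msqrt S *v z) (msqrt S *v u)"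
  proof -
    have eq: "(0 + msqrt S *v g) \<bullet> x = (msqrt S *v x) \<bullet> g" for g x
      by (metis sym inner_commute add_0)
    have "(\<lambda>x. iexp ((x \<bullet> z) * (x \<bullet> u))) \<in> borel_measurable borel" by measurable
    then show ?thesis unfolding bilinear_char_def by (simp only: integral_mvnormal eq)
  qed
  finally show ?thesis .
qed

text \<open>After exchanging the integrals, the Gaussian one turns the linear term into an
  exponential in \<zeta>; writing \<zeta> as a sum of independent squares then factors the
  integrand.\<close>

lemma chi2_mvnormal_mixture_char:
  "(CLINT x|std_mvnormal. CLINT \<zeta>|chi2 n. iexp (\<zeta> * b + sqrt \<zeta> * (w \<bullet> x)))
    = (CLINT h|std_normal. exp (complex_of_real (h\<^sup>2) * (\<i> * b - (w \<bullet> w) / 2))) ^ n"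
proof -
  define c where "c = \<i> * b - (w \<bullet> w) / 2"
  interpret prob_space std_normal by (rule prob_space_std_normal)
  interpret C: prob_space "chi2 n" by (rule prob_space_chi2)
  interpret G: prob_space "std_mvnormal :: (real^'a) measure" by (rule prob_space_std_mvnormal)
  have "(CLINT x|std_mvnormal. CLINT \<zeta>|chi2 n. iexp (\<zeta> * b + sqrt \<zeta> * (w \<bullet> x)))
      = (CLINT \<zeta>|chi2 n. CLINT x|std_mvnormal. iexp (\<zeta> * b + sqrt \<zeta> * (w \<bullet> x)))"
    by (rule trans[OF integral_complex_pair_fst(2)[symmetric] integral_complex_pair_fst(1)])
      (simp_all add: prob_space_chi2 prob_space_std_mvnormal)
  \<comment> \<open>The square \<open>(sqrt \<zeta>)\<^sup>2\<close> stays unsimplified, since it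
    equals \<zeta> only for nonnegative \<zeta>; that sign becomes available once \<zeta> is a sum
    of squares.\<close>
  also have "\<dots> = (CLINT \<zeta>|chi2 n. iexp (\<zeta> * b) * complex_of_real (exp (- (sqrt \<zeta>)\<^sup>2 * (w \<bullet> w) / 2)))"
  proof -
    have "(CLINT x|std_mvnormal. iexp (\<zeta> * b + sqrt \<zeta> * (w \<bullet> x)))
       = iexp (\<zeta> * b) * (CLINT x|std_mvnormal. iexp ((sqrt \<zeta> *\<^sub>R w) \<bullet> x))" for \<zeta>
      by (subst integral_mult_right_zero[symmetric]) (simp add: exp_add[symmetric] algebra_simps)
    moreover have "(sqrt \<zeta> *\<^sub>R w) \<bullet> (sqrt \<zeta> *\<^sub>R w) = (sqrt \<zeta>)\<^sup>2 * (w \<bullet> w)" for \<zeta>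
      by (simp only: inner_scaleR_left inner_scaleR_right power2_eq_square mult.assoc)
    ultimately show ?thesis by (simp only: std_mvnormal_char mult_minus_left)
  qed
  also have "\<dots> = (CLINT g|PiM {..<n} (\<lambda>_. std_normal). iexp ((\<Sum>i<n. (g i)\<^sup>2) * b)
        * complex_of_real (exp (- (sqrt (\<Sum>i<n. (g i)\<^sup>2))\<^sup>2 * (w \<bullet> w) / 2)))"
    unfolding chi2_def by (rule integral_distr) measurable
  also have "\<dots> = (CLINT g|PiM {..<n} (\<lambda>_. std_normal). \<Prod>i<n. exp (complex_of_real ((g i)\<^sup>2) * c))"
  proof -
    have "iexp (s * b) * complex_of_real (exp (- (sqrt s)\<^sup>2 * (w \<bullet> w) / 2)) = exp (complex_of_real s * c)"
      if "s \<ge> 0" for s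
      using that unfolding exp_of_real[symmetric] exp_add[symmetric] by (simp add: c_def algebra_simps)
    then show ?thesis
      by (simp only: sum_nonneg zero_le_power2 exp_sum[symmetric] finite_lessThan sum_distrib_right[symmetric] of_real_sum[symmetric])
  qed
  \<comment> \<open>The real part of \<open>c\<close> is \<open>- (w \<bullet> w) / 2\<close>, hence
    every factor is bounded by 1.\<close>
  also have "\<dots> = (CLINT h|std_normal. exp (complex_of_real (h\<^sup>2) * c)) ^ n"
    by (intro integral_PiM_power prob_space_std_normal integrable_const_bound[of _ 1])
      (auto simp: c_def norm_exp simp del: of_real_power)
  finally show ?thesis unfolding c_def .
qed

text \<open>With \<open>a = P t\<close>, the bracket in the theorem is the square root of \<open>(t \<bullet> t) I - a a\<^sup>T\<close>; for \<open>a = 0\<close>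
  the quotient is \<open>0 / 0 = 0\<close> and the claim still holds.\<close>
lemma norm_sqrt_rank_one_downdate:
  fixes a y :: "'a::real_inner"
  assumes m: "a \<bullet> a \<le> q"
  defines "w \<equiv> sqrt q *\<^sub>R y - ((sqrt q - sqrt (q - a \<bullet> a)) / (a \<bullet> a) * (a \<bullet> y)) *\<^sub>R a"
  shows "w \<bullet> w = q * (y \<bullet> y) - (a \<bullet> y)\<^sup>2"
proof (cases "a = 0")
  case True
  then show ?thesis using m by (simp add: w_def mult.assoc[symmetric])
next
  case False
  define c where "c = (sqrt q - sqrt (q - a \<bullet> a)) / (a \<bullet> a)"
  have q: "q \<ge> 0" using m by (meson inner_ge_zero order_trans)
  have ca: "c * (a \<bullet> a) = sqrt q - sqrt (q - a \<bullet> a)" using False by (simp add: c_def)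
  have "w \<bullet> w = (sqrt q)\<^sup>2 * (y \<bullet> y) - (2 * sqrt q * c - c * (c * (a \<bullet> a))) * (a \<bullet> y)\<^sup>2"
    unfolding w_def c_def[symmetric]
    by (simp add: inner_diff_left inner_diff_right inner_commute[of y a] power2_eq_square algebra_simps)
  \<comment> \<open>Multiplying by the conjugate sum of roots makes the coefficient of
    \<open>(a \<bullet> y)\<^sup>2\<close> a difference of squares over
    \<open>a \<bullet> a\<close>, namely 1.\<close>
  also have "2 * sqrt q * c - c * (c * (a \<bullet> a)) = c * (sqrt q + sqrt (q - a \<bullet> a))"
    unfolding ca by (simp add: algebra_simps)
  also have "\<dots> = ((sqrt q)\<^sup>2 - (sqrt (q - a \<bullet> a))\<^sup>2) / (a \<bullet> a)"
    unfolding c_def by (simp add: power2_eq_square algebra_simps)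
  also have "\<dots> = 1" using m q False by simp
  finally show ?thesis using q by simp
qed

section \<open>The distribution of the product\<close>

declare transpose_matrix_vector [simp del]

lemma matrix_inv_mult:
  assumes "invertible A"
  shows "A ** matrix_inv A = mat 1" "matrix_inv A ** A = mat 1"
  using someI_ex[OF assms[unfolded invertible_def]] by (simp_all add: matrix_inv_def)

lemma vouter_congruence:
  fixes A :: "real^'a^'c" and B :: "real^'b^'d"
  shows "A ** vouter x y ** transpose B = vouter (A *v x) (B *v y)"
  by (simp add: matrix_eq matrix_vector_mul_assoc[symmetric] vouter_mult_vector matrix_vector_mult_scaleR)
    (metis dot_lmul_matrix inner_commute vector_transpose_matrix transpose_transpose)

text \<open>If the root of \<open>M ** C ** transpose M\<close> kills \<open>x\<close>, then the
  squared norm of \<open>msqrt C *v (transpose M *v x)\<close> is zero, so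
  \<open>transpose (M ** C)\<close> kills \<open>x\<close>; full row rank of \<open>M ** C\<close>
  forces \<open>x = 0\<close>.\<close>

lemma invertible_msqrt_congruence:
  fixes M :: "real^'k^'p"
  assumes C: "psd C" and rank: "rank (M ** C) = CARD('p)"
  shows "invertible (msqrt (M ** C ** transpose M))"
proof -
  let ?R = "msqrt C" and ?S = "M ** C ** transpose M"
  have R: "psd ?R" "?R ** ?R = C" "transpose ?R = ?R"
    using msqrt[OF C] by (auto simp: psd_def)
  have S: "?S = (M ** ?R) ** transpose (M ** ?R)"
    by (simp add: matrix_transpose_mul R matrix_mul_assoc) (simp add: matrix_mul_assoc[symmetric] R)
  then have psdS: "psd ?S" using psd_congruence by metis
  have "x = 0" if x: "msqrt ?S *v x = 0" for x
  proof -
    have "?S *v x = 0"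
      using x msqrt_mult_self[OF psdS] by (metis matrix_vector_mul_assoc matrix_vector_mult_0_right)
    then have "x \<bullet> ((M ** ?R) *v (transpose (M ** ?R) *v x)) = 0"
      unfolding S by (simp add: matrix_vector_mul_assoc)
    then have "(transpose (M ** ?R) *v x) \<bullet> (transpose (M ** ?R) *v x) = 0"
      by (metis dot_lmul_matrix transpose_matrix_vector)
    then have "transpose (M ** ?R) *v x = 0" by simp
    then have "?R *v (transpose M *v x) = 0"
      by (simp add: matrix_transpose_mul R matrix_vector_mul_assoc)
    then have "C *v (transpose M *v x) = 0"
      using R(2) by (metis matrix_vector_mul_assoc matrix_vector_mult_0_right)
    then have "transpose (M ** C) *v x = 0"
      using C by (simp add: matrix_transpose_mul psd_def matrix_vector_mul_assoc)
    moreover have "inj ((*v) (transpose (M ** C)))"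
      using rank by (simp add: full_rank_injective[symmetric] rank_transpose)
    ultimately show "x = 0" by (metis injD matrix_vector_mult_0_right)
  qed
  then show ?thesis
    using matrix_left_invertible_ker invertible_left_inverse by blast
qed

theorem theorem1:
  fixes \<Omega> :: "'w measure"
    and A :: "'w \<Rightarrow> real^'k^'k" and z :: "'w \<Rightarrow> real^'k"
    and Sig :: "real^'k^'k" and mu :: "real^'k" and kappa :: real
    and Mm :: "real^'k^'p" and n r :: nat
  assumes "prob_space \<Omega>"
    and "psd Sig" and "rank Sig = r" and "r < CARD('k)"
    and "A \<in> borel_measurable \<Omega>" and "distr \<Omega> borel A = wishart n Sig"
    and "kappa > 0"
    and "z \<in> borel_measurable \<Omega>" and "distr \<Omega> borel z = mvnormal mu (kappa *\<^sub>R Sig)"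
    and "\<And>X Y. X \<in> sets borel \<Longrightarrow> Y \<in> sets borel \<Longrightarrow>
         measure \<Omega> (A -` X \<inter> z -` Y \<inter> space \<Omega>) =
         measure \<Omega> (A -` X \<inter> space \<Omega>) * measure \<Omega> (z -` Y \<inter> space \<Omega>)"
    and "rank Mm = CARD('p)" and "CARD('p) < r" and "r \<le> n"
    and "rank (Mm ** Sig) = CARD('p)"
  shows
    "let S = Mm ** Sig ** transpose Mm;
         P = minvsqrt S ** Mm ** msqrt Sig;
         Q = transpose P ** P
     in distr \<Omega> borel (\<lambda>\<omega>. Mm *v (A \<omega> *v z \<omega>)) =
        distr (chi2 n \<Otimes>\<^sub>M (mvnormal (msqrt Sig *v mu) (kappa *\<^sub>R (Sig ** Sig)) \<Otimes>\<^sub>M mvnormal 0 (mat 1)))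
          borel
          (\<lambda>(zeta, t, z0).
             zeta *\<^sub>R (Mm *v (msqrt Sig *v t)) +
             sqrt zeta *\<^sub>R (msqrt S *v
               ((sqrt (t \<bullet> t) *\<^sub>R mat 1
                 - ((sqrt (t \<bullet> t) - sqrt (t \<bullet> ((mat 1 - Q) *v t))) / (t \<bullet> (Q *v t)))
                   *\<^sub>R (P ** vouter t t ** transpose P)) *v z0)))"
proof -
  interpret prob_space \<Omega> by fact
  note Sig = assms(2) and A = assms(5,6) and z = assms(8,9)
  note A(1) [measurable] z(1) [measurable]
  define S where "S = Mm ** Sig ** transpose Mm"
  define R where "R = msqrt Sig"
  define T where "T = msqrt S"
  define P where "P = minvsqrt S ** Mm ** R"
  define Q where "Q = transpose P ** P"
  define F where "F = (\<lambda>(zeta, t, z0).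
             zeta *\<^sub>R (Mm *v (R *v t)) +
             sqrt zeta *\<^sub>R (T *v
               ((sqrt (t \<bullet> t) *\<^sub>R mat 1
                 - ((sqrt (t \<bullet> t) - sqrt (t \<bullet> ((mat 1 - Q) *v t))) / (t \<bullet> (Q *v t)))
                   *\<^sub>R (P ** vouter t t ** transpose P)) *v z0)))"
  have R: "psd R" "R ** R = Sig" "transpose R = R"
    unfolding R_def using msqrt[OF Sig] by (auto simp: psd_def)
  have S: "S = (Mm ** R) ** transpose (Mm ** R)"
    unfolding S_def by (simp add: matrix_transpose_mul R matrix_mul_assoc) (simp add: matrix_mul_assoc[symmetric] R)
  have psdS: "psd S" unfolding S by (rule psd_congruence)
  have T: "psd T" "T ** T = S" "transpose T = T"
    unfolding T_def using msqrt[OF psdS] by (auto simp: psd_def)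
  have "invertible T"
    unfolding T_def S_def using Sig assms(14) by (rule invertible_msqrt_congruence)
  then have Ti: "T ** matrix_inv T = mat 1" "matrix_inv T ** T = mat 1"
    by (simp_all add: matrix_inv_mult)
  have P: "P = matrix_inv T ** (Mm ** R)"
    by (simp add: P_def minvsqrt_def T_def matrix_mul_assoc)
  have TP: "T ** P = Mm ** R" by (simp add: P matrix_mul_assoc Ti)
  have TPt: "T *v (P *v t) = Mm *v (R *v t)" for t
    by (simp only: matrix_vector_mul_assoc TP)
  \<comment> \<open>By \<open>TP\<close>, sandwiching \<open>P ** transpose P\<close> between two
    copies of \<open>T\<close> gives \<open>S\<close>, which is also \<open>T ** T\<close>; the
    invertible \<open>T\<close> cancels.\<close>
  have PP: "P ** transpose P = mat 1"
  proof -
    have "T ** (P ** transpose P) ** T = T ** T"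
      using S T TP by (metis matrix_mul_assoc matrix_transpose_mul)
    then have "matrix_inv T ** (T ** (P ** transpose P) ** T) ** matrix_inv T = matrix_inv T ** (T ** T) ** matrix_inv T"
      by simp
    then show ?thesis by (metis Ti matrix_mul_assoc matrix_mul_lid matrix_mul_rid)
  qed
  have adj: "x \<bullet> (transpose L *v y) = (L *v x) \<bullet> y" for L :: "real^'m^'l" and x y
    by (metis dot_lmul_matrix inner_commute vector_transpose_matrix transpose_transpose)
  have Qt: "t \<bullet> (Q *v t) = (P *v t) \<bullet> (P *v t)" for t
    by (simp add: Q_def matrix_vector_mul_assoc[symmetric] adj)
  \<comment> \<open>By \<open>PP\<close> the transpose of \<open>P\<close> is an isometry, so
    Cauchy-Schwarz bounds the squared norm of \<open>P *v t\<close> by \<open>norm t\<close> times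
    its norm. This is the hypothesis of the rank-one lemma.\<close>
  have contr: "(P *v t) \<bullet> (P *v t) \<le> t \<bullet> t" for t
  proof -
    let ?a = "P *v t"
    have "norm (transpose P *v ?a) = norm ?a"
      unfolding norm_eq adj by (simp only: matrix_vector_mul_assoc[of P] PP matrix_vector_mul_lid)
    then have "?a \<bullet> ?a \<le> norm t * norm ?a"
      using Cauchy_Schwarz_ineq2[of t "transpose P *v ?a"] by (simp add: adj)
    then have "norm ?a * norm ?a \<le> norm t * norm ?a" by (simp add: power2_norm_eq_inner[symmetric] power2_eq_square)
    then have "norm ?a \<le> norm t" by (cases "norm ?a = 0") auto
    then show ?thesis by (simp add: norm_le)
  qed
  \<comment> \<open>Moving \<open>T\<close> and the symmetric bracket onto \<open>s\<close> exposes
    the vector of the rank-one lemma with \<open>a = P *v t\<close>, \<open>y = T *v s\<close> and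
    \<open>q = t \<bullet> t\<close>.\<close>
  have bracket: "s \<bullet> (T *v ((sqrt (t \<bullet> t) *\<^sub>R mat 1
                 - ((sqrt (t \<bullet> t) - sqrt (t \<bullet> ((mat 1 - Q) *v t))) / (t \<bullet> (Q *v t)))
                   *\<^sub>R (P ** vouter t t ** transpose P)) *v x))
       = (sqrt (t \<bullet> t) *\<^sub>R (T *v s) - ((sqrt (t \<bullet> t) - sqrt (t \<bullet> t - (P *v t) \<bullet> (P *v t))) / ((P *v t) \<bullet> (P *v t))
             * ((P *v t) \<bullet> (T *v s))) *\<^sub>R (P *v t)) \<bullet> x" for s t x
    unfolding psd_symD[OF T(1), of s] Qt
    by (simp add: matrix_vector_mult_diff_rdistrib scaleR_matrix_vector_assoc[symmetric] Qt
        matrix_vector_mul_assoc[symmetric] vouter_mult_vector adj matrix_vector_mult_scaleR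
        inner_diff_right inner_diff_left inner_commute[of "T *v s" "P *v t"])
  \<comment> \<open>As an outer product of \<open>P *v t\<close> with itself, the rank-one term
    falls under the measurability rules for \<open>vouter\<close>.\<close>
  have mF [measurable]: "F \<in> borel_measurable (chi2 n \<Otimes>\<^sub>M (mvnormal mu' C \<Otimes>\<^sub>M mvnormal 0 (mat 1)))" for mu' C
    unfolding F_def vouter_congruence by measurable
  have inner_char: "(CLINT x|std_mvnormal. CLINT \<zeta>|chi2 n. iexp (s \<bullet> F (\<zeta>, t, x)))
      = bilinear_char t (R *v (transpose Mm *v s)) ^ n" for s t
  proof -
    let ?a = "P *v t" and ?y = "T *v s" and ?v = "R *v (transpose Mm *v s)"
    define w where "w = sqrt (t \<bullet> t) *\<^sub>R ?y - ((sqrt (t \<bullet> t) - sqrt (t \<bullet> t - ?a \<bullet> ?a)) / (?a \<bullet> ?a) * (?a \<bullet> ?y)) *\<^sub>R ?a"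
    have b: "s \<bullet> (Mm *v (R *v t)) = t \<bullet> ?v"
      by (simp add: psd_symD[OF R(1)] adj inner_commute)
    have ay: "?a \<bullet> ?y = t \<bullet> ?v"
      unfolding psd_symD[OF T(1)] TPt b[symmetric] by (rule inner_commute)
    \<comment> \<open>Both sides are the quadratic form of \<open>S\<close> at \<open>s\<close>,
      since \<open>S\<close> factors through \<open>T\<close> and through
      \<open>Mm ** R\<close>.\<close>
    have yy: "?y \<bullet> ?y = ?v \<bullet> ?v"
    proof -
      have "?y \<bullet> ?y = s \<bullet> (S *v s)"
        by (simp add: psd_symD[OF T(1)] T(2)[symmetric] matrix_vector_mul_assoc[symmetric])
      also have "\<dots> = ?v \<bullet> ?v"
        unfolding S by (simp add: matrix_transpose_mul R matrix_vector_mul_assoc[symmetric] adj[symmetric] inner_commute)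
      finally show ?thesis .
    qed
    \<comment> \<open>This is the Gram determinant in \<open>bilinear_char_eq\<close>, which is why
      the two conditional characteristic functions coincide.\<close>
    have ww: "w \<bullet> w = (norm t)\<^sup>2 * (norm ?v)\<^sup>2 - (t \<bullet> ?v)\<^sup>2"
      unfolding w_def norm_sqrt_rank_one_downdate[OF contr] by (simp add: ay yy power2_norm_eq_inner)
    have "s \<bullet> F (\<zeta>, t, x) = \<zeta> * (t \<bullet> ?v) + sqrt \<zeta> * (w \<bullet> x)" for \<zeta> x
      by (simp add: F_def inner_add_right b bracket w_def)
    then show ?thesis
      by (simp only: chi2_mvnormal_mixture_char bilinear_char_eq ww)
  qed
  have "distr \<Omega> borel (\<lambda>\<omega>. Mm *v (A \<omega> *v z \<omega>)) =
        distr (chi2 n \<Otimes>\<^sub>M (mvnormal (R *v mu) (kappa *\<^sub>R (Sig ** Sig)) \<Otimes>\<^sub>M mvnormal 0 (mat 1))) borel F"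
    (is "?L = distr (_ \<Otimes>\<^sub>M (?N \<Otimes>\<^sub>M _)) _ _")
  proof (rule char_uniqueness)
    fix s :: "real^'p"
    let ?u = "transpose Mm *v s"
    \<comment> \<open>Independence, given on rectangles, identifies the joint law as the product
      measure and opens the way to Fubini.\<close>
    have pair: "distr \<Omega> (borel \<Otimes>\<^sub>M borel) (\<lambda>\<omega>. (A \<omega>, z \<omega>)) = wishart n Sig \<Otimes>\<^sub>M mvnormal mu (kappa *\<^sub>R Sig)"
    proof (rule pair_measure_eqI[symmetric])
      fix X Y assume "X \<in> sets (wishart n Sig)" "Y \<in> sets (mvnormal mu (kappa *\<^sub>R Sig))"
      then have [measurable]: "X \<in> sets borel" "Y \<in> sets borel" by auto
      have "(\<lambda>\<omega>. (A \<omega>, z \<omega>)) -` (X \<times> Y) \<inter> space \<Omega> = A -` X \<inter> z -` Y \<inter> space \<Omega>" by auto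
      then show "emeasure (wishart n Sig) X * emeasure (mvnormal mu (kappa *\<^sub>R Sig)) Y
        = emeasure (distr \<Omega> (borel \<Otimes>\<^sub>M borel) (\<lambda>\<omega>. (A \<omega>, z \<omega>))) (X \<times> Y)"
        unfolding A(2)[symmetric] z(2)[symmetric]
        by (simp add: emeasure_distr emeasure_eq_measure ennreal_mult[symmetric] assms(10))
    qed (simp_all add: prob_space_imp_sigma_finite prob_space_wishart prob_space_mvnormal cong: sets_pair_measure_cong)
    have "(CLINT x|?L. iexp (s \<bullet> x)) = (CLINT \<omega>|\<Omega>. iexp (?u \<bullet> (A \<omega> *v z \<omega>)))"
    proof -
      have "s \<bullet> (Mm *v y) = ?u \<bullet> y" for y
        by (metis adj inner_commute)
      then show ?thesis by (subst integral_distr) auto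
    qed
    also have "\<dots> = (\<integral>p. (case p of (A, z) \<Rightarrow> iexp (?u \<bullet> (A *v z))) \<partial>(wishart n Sig \<Otimes>\<^sub>M mvnormal mu (kappa *\<^sub>R Sig)))"
      unfolding pair[symmetric] by (subst integral_distr) auto
    \<comment> \<open>The Wishart matrix is integrated out first, with \<open>z\<close>
      fixed.\<close>
    also have "\<dots> = (CLINT z|mvnormal mu (kappa *\<^sub>R Sig). CLINT A|wishart n Sig. iexp (?u \<bullet> (A *v z)))"
      by (rule integral_complex_pair_fst(2)) (auto intro: prob_space_wishart prob_space_mvnormal)
    also have "\<dots> = (CLINT z|mvnormal mu (kappa *\<^sub>R Sig). bilinear_char (R *v z) (R *v ?u) ^ n)"
      by (simp only: wishart_bilinear_char[OF Sig] R_def)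
    finally have L: "(CLINT x|?L. iexp (s \<bullet> x)) = \<dots>" .
    show "(CLINT x|?L. iexp (s \<bullet> x)) = (CLINT x|distr (chi2 n \<Otimes>\<^sub>M (?N \<Otimes>\<^sub>M mvnormal 0 (mat 1))) borel F. iexp (s \<bullet> x))"
    proof -
      interpret C: prob_space "chi2 n" by (rule prob_space_chi2)
      interpret G: prob_space "std_mvnormal :: (real^'k) measure" by (rule prob_space_std_mvnormal)
      have m1: "(\<lambda>(\<zeta>, p). iexp (s \<bullet> F (\<zeta>, p))) \<in> borel_measurable (chi2 n \<Otimes>\<^sub>M (?N \<Otimes>\<^sub>M std_mvnormal))"
        using mF[of "R *v mu" "kappa *\<^sub>R (Sig ** Sig)"] unfolding mvnormal_0_mat_1 by measurable
      have m2: "(\<lambda>(t, x). CLINT \<zeta>|chi2 n. iexp (s \<bullet> F (\<zeta>, t, x))) \<in> borel_measurable (?N \<Otimes>\<^sub>M std_mvnormal)"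
      proof -
        have "(\<lambda>(p, \<zeta>). iexp (s \<bullet> F (\<zeta>, p))) \<in> borel_measurable ((?N \<Otimes>\<^sub>M std_mvnormal) \<Otimes>\<^sub>M chi2 n)"
          using measurable_compose[OF measurable_pair_swap' m1] by (simp add: case_prod_unfold)
        from C.borel_measurable_lebesgue_integral[OF this] show ?thesis by (simp add: case_prod_unfold)
      qed
      have n2: "norm (CLINT \<zeta>|chi2 n. iexp (s \<bullet> F (\<zeta>, t, x))) \<le> 1" for t x
        using integral_norm_bound[of "chi2 n" "\<lambda>\<zeta>. iexp (s \<bullet> F (\<zeta>, t, x))"] by (simp add: C.prob_space)
      have bm: "(\<lambda>t. bilinear_char t (R *v ?u)) \<in> borel_measurable borel"
        unfolding bilinear_char_def by (rule G.borel_measurable_lebesgue_integral) measurable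
      have sq: "msqrt (kappa *\<^sub>R Sig) = sqrt kappa *\<^sub>R R" "msqrt (kappa *\<^sub>R (Sig ** Sig)) = sqrt kappa *\<^sub>R Sig"
        using msqrt_scaleR_square[OF R(1), of kappa] msqrt_scaleR_square[OF Sig, of kappa] \<open>kappa > 0\<close> R(2) by simp_all
      have "(CLINT x|distr (chi2 n \<Otimes>\<^sub>M (?N \<Otimes>\<^sub>M mvnormal 0 (mat 1))) borel F. iexp (s \<bullet> x))
        = (\<integral>p. (case p of (\<zeta>, p) \<Rightarrow> iexp (s \<bullet> F (\<zeta>, p))) \<partial>(chi2 n \<Otimes>\<^sub>M (?N \<Otimes>\<^sub>M std_mvnormal)))"
        using mF unfolding mvnormal_0_mat_1 by (subst integral_distr) (auto simp: case_prod_unfold)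
      \<comment> \<open>Here \<zeta> is integrated out first, then the standard normal vector, with
        \<open>t\<close> last, matching \<open>inner_char\<close>.\<close>
      also have "\<dots> = (\<integral>p. (CLINT \<zeta>|chi2 n. iexp (s \<bullet> F (\<zeta>, p))) \<partial>(?N \<Otimes>\<^sub>M std_mvnormal))"
        by (rule integral_complex_pair_fst(2)[OF _ _ m1])
          (auto intro!: prob_space_pair prob_space_chi2 prob_space_mvnormal prob_space_std_mvnormal)
      also have "\<dots> = (\<integral>p. (case p of (t, x) \<Rightarrow> CLINT \<zeta>|chi2 n. iexp (s \<bullet> F (\<zeta>, t, x))) \<partial>(?N \<Otimes>\<^sub>M std_mvnormal))"
        by (simp only: case_prod_unfold prod.collapse)
      also have "\<dots> = (\<integral>t. (CLINT x|std_mvnormal. CLINT \<zeta>|chi2 n. iexp (s \<bullet> F (\<zeta>, t, x))) \<partial>?N)"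
        by (rule integral_complex_pair_fst(1)[OF _ _ m2 n2]) (auto intro!: prob_space_mvnormal prob_space_std_mvnormal)
      also have "\<dots> = (\<integral>t. bilinear_char t (R *v ?u) ^ n \<partial>?N)"
        by (simp only: inner_char)
      also have "\<dots> = (\<integral>g. bilinear_char (R *v mu + sqrt kappa *\<^sub>R (Sig *v g)) (R *v ?u) ^ n \<partial>std_mvnormal)"
        using bm by (subst integral_mvnormal) (simp_all add: sq scaleR_matrix_vector_assoc)
      \<comment> \<open>Since \<open>R ** R = Sig\<close>, the same standard normal \<open>g\<close>
        generates \<open>t\<close> directly and as \<open>R *v z\<close>, so \<open>R *v z\<close>
        has the law prescribed for \<open>t\<close>.\<close>
      also have "\<dots> = (\<integral>g. bilinear_char (R *v (mu + msqrt (kappa *\<^sub>R Sig) *v g)) (R *v ?u) ^ n \<partial>std_mvnormal)"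
        by (simp add: sq matrix_vector_right_distrib matrix_vector_mult_scaleR scaleR_matrix_vector_assoc[symmetric]
            matrix_vector_mul_assoc R)
      also have "\<dots> = (CLINT z|mvnormal mu (kappa *\<^sub>R Sig). bilinear_char (R *v z) (R *v ?u) ^ n)"
        using measurable_compose[OF _ bm, of "(*v) R" borel] by (subst integral_mvnormal) auto
      finally show ?thesis using L by simp
    qed
  qed (auto intro!: prob_space.prob_space_distr prob_space_axioms prob_space_pair prob_space_chi2 prob_space_mvnormal)
  then show ?thesis
    unfolding Let_def F_def Q_def P_def T_def R_def S_def .
qed

end
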